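(* Let $S$ be a finite set, $C\subset S$, $\mu$ a probability mass function on $S$, $r:S\to\mathbb{R}$, and $(P_k(\epsilon):k\ge1,\epsilon>0)$ a family of stochastic matrices on $S$. Let $B_k(\epsilon)=(P_k(\epsilon,x,y):x,y\in C)$, let $r_k(\epsilon)=(r_k(\epsilon,x):x\in C)$ with $r_k(\epsilon,x)=r(x)+\sum_{y\in C^c}P_k(\epsilon,x,y)r(y)$, and put $$\delta(\epsilon)=\sum_{j=0}^{\infty}\mu\left(\prod_{k=1}^{j}B_k(\epsilon)\right)r_{j+1}(\epsilon),$$ where $\mu$ is here (and below) understood as the row vector $(\mu(x):x\in C)$. Assume that there exist an integer $l\ge1$, scalars $s>0$, $\gamma>0$, and $S\times S$ matrices $\tilde P$ and $\tilde P^{(1)}$ (not depending on $\epsilon$) such that: (i) $\sup_{1\le i\le(\log(1/\epsilon))^{1+\gamma}}\|P_i(\epsilon)-(\tilde P+\epsilon(i-1)\tilde P^{(1)})\|=O(\epsilon^2(\log(1/\epsilon))^s)$ as $\epsilon\downarrow0$; (ii) $\sup_{k\ge0,\,\epsilon>0}\|B_{k+1}(\epsilon)B_{k+2}(\epsilon)\cdots B_{k+l}(\epsilon)\|<1$. Then there exists $w<\infty$ such that $$\delta(\epsilon)=\mu(I-\tilde B)^{-1}\tilde r+\epsilon\mu\tilde B(I-\tilde B)^{-2}\tilde B^{(1)}(I-\tilde B)^{-1}\tilde r+\epsilon\mu\tilde B(I-\tilde B)^{-2}\tilde r^{(1)}+O(\epsilon^2(\log(1/\epsilon))^w)$$ as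 $\epsilon\downarrow0$, where, for $x\in C$, $\tilde r(x)=r(x)+\sum_{y\in C^c}\tilde P(x,y)r(y)$, $\tilde r^{(1)}(x)=\sum_{y\in C^c}\tilde P^{(1)}(x,y)r(y)$, and $\tilde B=(\tilde P(x,y):x,y\in C)$, $\tilde B^{(1)}=(\tilde P^{(1)}(x,y):x,y\in C)$.
   Context: Matrix products are taken in increasing order of index, and an empty product is the identity. The matrix norm is $\|A\|=\max_x\sum_y|A(x,y)|$. Probability mass functions are row vectors and functions are column vectors. $C^c=S\setminus C$. The quantity $\delta(\epsilon)$ represents the expected reward $E\sum_{j=0}^{T}r(X_j)$ cumulated up to the hitting time $T=\inf\{n\ge0:X_n\in C^c\}$ by the chain with $k$-th step transition matrix $P_k(\epsilon)$. *)

theory Defs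
  imports "HOL-Analysis.Analysis" "HOL-Library.Landau_Symbols"
begin

(* The finite set S is the universe of the type 's. *)

definition prob_vec :: "real ^ 's::finite \<Rightarrow> bool" where
  "prob_vec v \<longleftrightarrow> (\<forall>x. 0 \<le> v $ x) \<and> (\<Sum>x\<in>UNIV. v $ x) = 1"

definition stochastic :: "real ^ 's ^ 's::finite \<Rightarrow> bool" where
  "stochastic P \<longleftrightarrow> (\<forall>x. prob_vec (P $ x))"

definition mat_norm :: "real ^ 's ^ 's::finite \<Rightarrow> real" where
  "mat_norm A = Max (range (\<lambda>x. \<Sum>y\<in>UNIV. \<bar>A $ x $ y\<bar>))"

(* matprod A n = A 1 ** A 2 ** ... ** A n.  The power operation on real ^ 's ^ 's is
   entrywise, so it is never used for matrix powers here. *)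
primrec matprod :: "(nat \<Rightarrow> real ^ 's ^ 's::finite) \<Rightarrow> nat \<Rightarrow> real ^ 's ^ 's" where
  "matprod A 0 = mat 1"
| "matprod A (Suc n) = matprod A n ** A (Suc n)"

(* A vector or matrix indexed by the subset C is represented by its extension by zero to
   all of 's.  This includes the case C = {}.  Extension by zero commutes with sums,
   products and mat_norm; the matrix I - B over C is represented by mat 1 - B, which is
   block diagonal with the identity on the complement of C, so that its inverse restricts
   to the inverse over C.  Likewise an empty product, mat 1, acts as the identity on the
   extended vectors. *)

definition restrict_vec :: "'s set \<Rightarrow> real ^ 's \<Rightarrow> real ^ 's::finite" where
  "restrict_vec C v = (\<chi> x. if x \<in> C then v $ x else 0)"

definition restrict_mat :: "'s set \<Rightarrow> real ^ 's ^ 's \<Rightarrow> real ^ 's ^ 's::finite" where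
  "restrict_mat C A = (\<chi> x y. if x \<in> C \<and> y \<in> C then A $ x $ y else 0)"

definition exit_reward :: "'s set \<Rightarrow> real ^ 's \<Rightarrow> real ^ 's ^ 's \<Rightarrow> real ^ 's::finite" where
  "exit_reward C r A = restrict_vec C (\<chi> x. \<Sum>y\<in>-C. A $ x $ y * r $ y)"

definition step_reward :: "'s set \<Rightarrow> real ^ 's \<Rightarrow> real ^ 's ^ 's \<Rightarrow> real ^ 's::finite" where
  "step_reward C r A = restrict_vec C (\<chi> x. r $ x + (\<Sum>y\<in>-C. A $ x $ y * r $ y))"

definition cumulated_reward ::
  "'s set \<Rightarrow> real ^ 's \<Rightarrow> real ^ 's \<Rightarrow> (nat \<Rightarrow> real \<Rightarrow> real ^ 's ^ 's::finite) \<Rightarrow> real \<Rightarrow> real" where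
  "cumulated_reward C \<mu> r P \<epsilon> =
     (\<Sum>j. (restrict_vec C \<mu> v* matprod (\<lambda>k. restrict_mat C (P k \<epsilon>)) j)
            \<bullet> step_reward C r (P (Suc j) \<epsilon>))"

lemma mat_norm_restrict_mat:
  assumes "C \<noteq> {}"
  shows "mat_norm (restrict_mat C A) = Max ((\<lambda>x. \<Sum>y\<in>C. \<bar>A $ x $ y\<bar>) ` C)"
proof -
  let ?f = "\<lambda>x. \<Sum>y\<in>C. \<bar>A $ x $ y\<bar>"
  have row: "(\<Sum>y\<in>UNIV. \<bar>restrict_mat C A $ x $ y\<bar>) = (if x \<in> C then ?f x else 0)" for x
    by (auto simp: restrict_mat_def intro!: sum.mono_neutral_cong_right)
  have fin: "finite C" by simp
  have nn: "0 \<le> Max (?f ` C)"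
  proof -
    obtain c where c: "c \<in> C" using assms by blast
    have "0 \<le> ?f c" by (simp add: sum_nonneg)
    also have "\<dots> \<le> Max (?f ` C)" using c fin by (intro Max_ge) auto
    finally show ?thesis .
  qed
  show ?thesis
    unfolding mat_norm_def row
  proof (rule Max_eqI)
    show "Max (?f ` C) \<in> range (\<lambda>x. if x \<in> C then ?f x else 0)"
    proof -
      have "Max (?f ` C) \<in> ?f ` C" using assms fin by (intro Max_in) auto
      then obtain c where "c \<in> C" "Max (?f ` C) = ?f c" by blast
      then have "Max (?f ` C) = (if c \<in> C then ?f c else 0)" by simp
      then show ?thesis by blast
    qed
  qed (use nn fin in \<open>auto intro: Max_ge\<close>)
qed

lemma restrict_mat_mult_nth:
  "(restrict_mat C A ** restrict_mat C B) $ x $ y =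
     (if x \<in> C \<and> y \<in> C then \<Sum>z\<in>C. A $ x $ z * B $ z $ y else 0)"
  by (auto simp: matrix_matrix_mult_def restrict_mat_def intro!: sum.mono_neutral_cong_right)

lemma matrix_inv_one_minus_restrict_mat:
  fixes A :: "real ^ 's ^ 's::finite"
  assumes inv: "invertible (mat 1 - restrict_mat C A)"
  defines "N \<equiv> matrix_inv (mat 1 - restrict_mat C A)"
  shows "x \<notin> C \<or> y \<notin> C \<Longrightarrow> N $ x $ y = (if x = y then 1 else 0)"
    and "x \<in> C \<Longrightarrow> y \<in> C \<Longrightarrow>
      (\<Sum>z\<in>C. N $ x $ z * ((if z = y then 1 else 0) - A $ z $ y)) = (if x = y then 1 else 0)"
    and "x \<in> C \<Longrightarrow> y \<in> C \<Longrightarrow>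
      (\<Sum>z\<in>C. ((if x = z then 1 else 0) - A $ x $ z) * N $ z $ y) = (if x = y then 1 else 0)"
proof -
  let ?M = "mat 1 - restrict_mat C A"
  have ex: "\<exists>N. ?M ** N = mat 1 \<and> N ** ?M = mat 1"
    using inv by (simp add: invertible_def)
  have N: "?M ** N = mat 1 \<and> N ** ?M = mat 1"
    unfolding N_def matrix_inv_def by (rule someI_ex[OF ex])
  have M: "?M $ x $ y = (if x \<in> C \<and> y \<in> C then (if x = y then 1 else 0) - A $ x $ y
             else if x = y then 1 else 0)" for x y
    by (auto simp: mat_def restrict_mat_def)
  have r: "(\<Sum>z\<in>UNIV. ?M $ x $ z * N $ z $ y) = (if x = y then 1 else 0)" for x y
    using arg_cong[OF conjunct1[OF N], of "\<lambda>M. M $ x $ y"]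
    by (simp add: matrix_matrix_mult_def mat_def)
  have l: "(\<Sum>z\<in>UNIV. N $ x $ z * ?M $ z $ y) = (if x = y then 1 else 0)" for x y
    using arg_cong[OF conjunct2[OF N], of "\<lambda>M. M $ x $ y"]
    by (simp add: matrix_matrix_mult_def mat_def)
  have outr: "N $ x $ y = (if x = y then 1 else 0)" if "x \<notin> C" for x y
  proof -
    have "(\<Sum>z\<in>UNIV. ?M $ x $ z * N $ z $ y) = (\<Sum>z\<in>UNIV. if z = x then N $ z $ y else 0)"
      unfolding M using that by (intro sum.cong) auto
    also have "\<dots> = N $ x $ y" by simp
    finally show ?thesis using r[of x y] by simp
  qed
  have outc: "N $ x $ y = (if x = y then 1 else 0)" if "y \<notin> C" for x y
  proof -
    have "(\<Sum>z\<in>UNIV. N $ x $ z * ?M $ z $ y) = (\<Sum>z\<in>UNIV. if z = y then N $ x $ z else 0)"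
      unfolding M using that by (intro sum.cong) auto
    also have "\<dots> = N $ x $ y" by simp
    finally show ?thesis using l[of x y] by simp
  qed
  show "N $ x $ y = (if x = y then 1 else 0)" if "x \<notin> C \<or> y \<notin> C"
    using outr outc that by blast
  show "(\<Sum>z\<in>C. N $ x $ z * ((if z = y then 1 else 0) - A $ z $ y)) = (if x = y then 1 else 0)"
    if "x \<in> C" "y \<in> C"
  proof -
    have "(\<Sum>z\<in>C. N $ x $ z * ((if z = y then 1 else 0) - A $ z $ y))
        = (\<Sum>z\<in>UNIV. N $ x $ z * ?M $ z $ y)"
      unfolding M using that by (intro sum.mono_neutral_cong_left) auto
    then show ?thesis using l[of x y] by simp
  qed
  show "(\<Sum>z\<in>C. ((if x = z then 1 else 0) - A $ x $ z) * N $ z $ y) = (if x = y then 1 else 0)"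
    if "x \<in> C" "y \<in> C"
  proof -
    have "(\<Sum>z\<in>C. ((if x = z then 1 else 0) - A $ x $ z) * N $ z $ y)
        = (\<Sum>z\<in>UNIV. ?M $ x $ z * N $ z $ y)"
      unfolding M using that by (intro sum.mono_neutral_cong_left) auto
    then show ?thesis using r[of x y] by simp
  qed
qed

end

theory Submission
  imports Defs "HOL-Real_Asymp.Real_Asymp"
begin

text \<open>
  The expected reward still to be collected after \<open>k\<close> steps satisfies the backward equation
  \<open>g\<^sub>k = r\<^sub>k\<^sub>+\<^sub>1 + B\<^sub>k\<^sub>+\<^sub>1 g\<^sub>k\<^sub>+\<^sub>1\<close>. The ansatz \<open>g\<^sub>k = a + \<epsilon> k b + \<epsilon> c\<close> solves it to first order in \<open>\<epsilon>\<close>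
  exactly when \<open>(I - B) a = r\<close>, \<open>(I - B) b = r1 + B1 a\<close> and \<open>(I - B) c = B b\<close>, and then \<open>\<mu> g\<^sub>0\<close> is the
  claimed expansion. Telescoping bounds the error by the sum of the defects of order
  \<open>\<epsilon>\<^sup>2\<close> (up to logarithms) over \<open>k < n\<close>, where \<open>n\<close> is the integer part of \<open>(log (1/\<epsilon>))\<close> to the power \<open>1 + \<gamma>\<close>,
  plus a tail of size \<open>O(\<rho>\<^sup>n)\<close> with \<open>\<rho> < 1\<close>, which is smaller than \<open>\<epsilon>\<^sup>2\<close>. Invertibility of \<open>I - B\<close>
  comes from the same telescoping, applied to a constant sequence \<open>g\<close> with \<open>B g = g\<close>.
\<close>

section \<open>The sup norm on vectors and the row-sum norm on matrices\<close>

lemma infnorm_le_iff_cart: "infnorm (x :: real ^ 'n) \<le> c \<longleftrightarrow> (\<forall>i. \<bar>x $ i\<bar> \<le> c)"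
proof
  assume "\<forall>i. \<bar>x $ i\<bar> \<le> c"
  then show "infnorm x \<le> c"
    unfolding infnorm_cart by (intro cSup_least) auto
qed (auto intro: order_trans[OF component_le_infnorm_cart])

lemma infnorm_scaleR: "infnorm (a *\<^sub>R x) = \<bar>a\<bar> * infnorm x"
  using infnorm_mul[of a x] by simp

lemma infnorm_sum_le: "infnorm (\<Sum>i\<in>I. f i) \<le> (\<Sum>i\<in>I. infnorm (f i))"
proof (induction I rule: infinite_finite_induct)
  case (insert i I)
  then show ?case
    using infnorm_triangle[of "f i" "sum f I"] by simp
qed (simp_all add: infnorm_0)

text \<open>Hoelder's inequality for the 1-norm and the sup norm. It serves both for the rows of a
  matrix acting on a vector and for the row vector of initial weights.\<close>

lemma abs_inner_le_infnorm:
  fixes v x :: "real ^ 'n::finite"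
  shows "\<bar>v \<bullet> x\<bar> \<le> (\<Sum>i\<in>UNIV. \<bar>v $ i\<bar>) * infnorm x"
proof -
  have "\<bar>v \<bullet> x\<bar> \<le> (\<Sum>i\<in>UNIV. \<bar>v $ i * x $ i\<bar>)"
    by (simp add: inner_vec_def sum_abs)
  also have "\<dots> \<le> (\<Sum>i\<in>UNIV. \<bar>v $ i\<bar> * infnorm x)"
    by (intro sum_mono) (simp add: abs_mult mult_left_mono component_le_infnorm_cart)
  finally show ?thesis by (simp add: sum_distrib_right)
qed

lemma row_sum_le_mat_norm: "(\<Sum>y\<in>UNIV. \<bar>A $ x $ y\<bar>) \<le> mat_norm A"
  unfolding mat_norm_def by (rule Max_ge) auto

lemma mat_norm_le_iff: "mat_norm A \<le> c \<longleftrightarrow> (\<forall>x. (\<Sum>y\<in>UNIV. \<bar>A $ x $ y\<bar>) \<le> c)"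
  unfolding mat_norm_def by (subst Max_le_iff) auto

lemma mat_norm_nonneg [simp]: "0 \<le> mat_norm A"
  by (rule order_trans[OF _ row_sum_le_mat_norm[of A undefined]]) (simp add: sum_nonneg)

text \<open>The row-sum norm is compatible with the sup norm, which is why vectors are measured in
  \<open>infnorm\<close> throughout.\<close>

lemma infnorm_matrix_vector_mult_le: "infnorm (A *v x) \<le> mat_norm A * infnorm x"
  unfolding infnorm_le_iff_cart
proof
  fix i
  have "\<bar>(A *v x) $ i\<bar> \<le> (\<Sum>j\<in>UNIV. \<bar>A $ i $ j\<bar>) * infnorm x"
    using abs_inner_le_infnorm[of "A $ i" x] by (simp add: matrix_vector_mul_component)
  also have "\<dots> \<le> mat_norm A * infnorm x"
    by (intro mult_right_mono row_sum_le_mat_norm infnorm_pos_le)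
  finally show "\<bar>(A *v x) $ i\<bar> \<le> mat_norm A * infnorm x" .
qed

lemma mat_norm_mult_le: "mat_norm (A ** B) \<le> mat_norm A * mat_norm B"
  unfolding mat_norm_le_iff
proof
  fix x
  have "(\<Sum>y\<in>UNIV. \<bar>(A ** B) $ x $ y\<bar>) \<le> (\<Sum>y\<in>UNIV. \<Sum>z\<in>UNIV. \<bar>A $ x $ z\<bar> * \<bar>B $ z $ y\<bar>)"
    by (intro sum_mono) (simp add: matrix_matrix_mult_def flip: abs_mult)
  also have "\<dots> = (\<Sum>z\<in>UNIV. \<bar>A $ x $ z\<bar> * (\<Sum>y\<in>UNIV. \<bar>B $ z $ y\<bar>))"
    by (subst sum.swap) (simp add: sum_distrib_left)
  also have "\<dots> \<le> (\<Sum>z\<in>UNIV. \<bar>A $ x $ z\<bar> * mat_norm B)"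
    by (intro sum_mono mult_left_mono row_sum_le_mat_norm) simp
  also have "\<dots> \<le> mat_norm A * mat_norm B"
    unfolding sum_distrib_right[symmetric] by (intro mult_right_mono row_sum_le_mat_norm) simp
  finally show "(\<Sum>y\<in>UNIV. \<bar>(A ** B) $ x $ y\<bar>) \<le> mat_norm A * mat_norm B" .
qed

lemma mat_norm_mat_1: "mat_norm (mat 1) \<le> 1"
  by (simp add: mat_norm_le_iff mat_def if_distrib cong: if_cong)

lemma mat_norm_triangle: "mat_norm (A + B) \<le> mat_norm A + mat_norm B"
  unfolding mat_norm_le_iff
proof
  fix x
  have "(\<Sum>y\<in>UNIV. \<bar>(A + B) $ x $ y\<bar>) \<le> (\<Sum>y\<in>UNIV. \<bar>A $ x $ y\<bar>) + (\<Sum>y\<in>UNIV. \<bar>B $ x $ y\<bar>)"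
    by (simp add: abs_triangle_ineq sum_mono flip: sum.distrib)
  then show "(\<Sum>y\<in>UNIV. \<bar>(A + B) $ x $ y\<bar>) \<le> mat_norm A + mat_norm B"
    using row_sum_le_mat_norm[of A x] row_sum_le_mat_norm[of B x] by linarith
qed

lemma mat_norm_scaleR: "mat_norm (a *\<^sub>R A) \<le> \<bar>a\<bar> * mat_norm A"
  unfolding mat_norm_le_iff
  by (simp add: abs_mult mult_left_mono row_sum_le_mat_norm flip: sum_distrib_left)

lemma mat_norm_stochastic: "stochastic A \<Longrightarrow> mat_norm A \<le> 1"
  by (simp add: mat_norm_le_iff stochastic_def prob_vec_def)

lemma mat_norm_restrict_mat_le: "mat_norm (restrict_mat C A) \<le> mat_norm A"
  unfolding mat_norm_le_iff
proof
  fix x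
  have "(\<Sum>y\<in>UNIV. \<bar>restrict_mat C A $ x $ y\<bar>) \<le> (\<Sum>y\<in>UNIV. \<bar>A $ x $ y\<bar>)"
    by (intro sum_mono) (simp add: restrict_mat_def)
  then show "(\<Sum>y\<in>UNIV. \<bar>restrict_mat C A $ x $ y\<bar>) \<le> mat_norm A"
    by (rule order_trans[OF _ row_sum_le_mat_norm])
qed

section \<open>Dependence of blocks and rewards on the transition matrix\<close>

lemma restrict_mat_add: "restrict_mat C (A + B) = restrict_mat C A + restrict_mat C B"
  by (simp add: restrict_mat_def vec_eq_iff)

lemma restrict_mat_scaleR: "restrict_mat C (a *\<^sub>R A) = a *\<^sub>R restrict_mat C A"
  by (simp add: restrict_mat_def vec_eq_iff)

lemma exit_reward_add: "exit_reward C r (A + B) = exit_reward C r A + exit_reward C r B"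
  by (simp add: exit_reward_def restrict_vec_def vec_eq_iff sum.distrib distrib_right)

lemma exit_reward_scaleR: "exit_reward C r (a *\<^sub>R A) = a *\<^sub>R exit_reward C r A"
  by (simp add: exit_reward_def restrict_vec_def vec_eq_iff sum_distrib_left mult.assoc)

text \<open>Isolates the part of the one-step reward that is linear in the matrix; a perturbation of
  the matrix changes only this part.\<close>

lemma step_reward_eq: "step_reward C r A = restrict_vec C r + exit_reward C r A"
  by (simp add: step_reward_def exit_reward_def restrict_vec_def vec_eq_iff)

lemma infnorm_exit_reward_le: "infnorm (exit_reward C r A) \<le> mat_norm A * infnorm r"
  unfolding infnorm_le_iff_cart
proof
  fix x
  have "\<bar>\<Sum>y\<in>-C. A $ x $ y * r $ y\<bar> \<le> (\<Sum>y\<in>-C. \<bar>A $ x $ y\<bar> * infnorm r)"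
    by (rule order_trans[OF sum_abs])
      (auto simp: abs_mult intro!: sum_mono mult_left_mono component_le_infnorm_cart)
  also have "\<dots> \<le> (\<Sum>y\<in>UNIV. \<bar>A $ x $ y\<bar> * infnorm r)"
    by (intro sum_mono2) (auto simp: infnorm_pos_le)
  also have "\<dots> \<le> mat_norm A * infnorm r"
    unfolding sum_distrib_right[symmetric]
    by (intro mult_right_mono row_sum_le_mat_norm infnorm_pos_le)
  finally show "\<bar>exit_reward C r A $ x\<bar> \<le> mat_norm A * infnorm r"
    by (auto simp: exit_reward_def restrict_vec_def infnorm_pos_le)
qed

lemma infnorm_step_reward_le: "infnorm (step_reward C r A) \<le> (1 + mat_norm A) * infnorm r"
proof -
  have "infnorm (restrict_vec C r) \<le> infnorm r"
    unfolding infnorm_le_iff_cart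
    by (simp add: restrict_vec_def component_le_infnorm_cart infnorm_pos_le)
  then show ?thesis
    using infnorm_triangle[of "restrict_vec C r" "exit_reward C r A"]
      infnorm_exit_reward_le[of C r A]
    unfolding step_reward_eq by (simp add: algebra_simps)
qed

section \<open>Decay of matrix products and telescoping along them\<close>

lemma matprod_add: "matprod A (m + n) = matprod A m ** matprod (\<lambda>i. A (m + i)) n"
  by (induction n) (simp_all add: matrix_mul_assoc)

lemma mat_norm_matprod_le_1:
  assumes "\<And>k. k \<ge> 1 \<Longrightarrow> mat_norm (A k) \<le> 1"
  shows "mat_norm (matprod A n) \<le> 1"
proof (induction n)
  case (Suc n)
  have "mat_norm (matprod A (Suc n)) \<le> mat_norm (matprod A n) * mat_norm (A (Suc n))"
    by (simp add: mat_norm_mult_le)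
  also have "\<dots> \<le> 1 * 1"
    using assms Suc by (intro mult_mono) auto
  finally show ?case by simp
qed (simp add: mat_norm_mat_1)

text \<open>Cut the product into \<open>n div l\<close> consecutive blocks of length
  \<open>l\<close>, each contributing a factor \<theta>, and a remainder of \<open>n mod l\<close>
  factors, each of norm at most 1.\<close>

lemma mat_norm_matprod_le_power:
  assumes A: "\<And>k. k \<ge> 1 \<Longrightarrow> mat_norm (A k) \<le> 1"
    and block: "\<And>k. mat_norm (matprod (\<lambda>i. A (k + i)) l) \<le> \<theta>"
  shows "mat_norm (matprod A n) \<le> \<theta> ^ (n div l)"
proof -
  have \<theta>: "0 \<le> \<theta>"
    by (rule order_trans[OF mat_norm_nonneg block])
  have blocks: "mat_norm (matprod A (q * l)) \<le> \<theta> ^ q" for q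
  proof (induction q)
    case (Suc q)
    have "mat_norm (matprod A (Suc q * l))
        \<le> mat_norm (matprod A (q * l)) * mat_norm (matprod (\<lambda>i. A (q * l + i)) l)"
      using matprod_add[of A "q * l" l] mat_norm_mult_le by (simp add: add.commute)
    also have "\<dots> \<le> \<theta> ^ q * \<theta>"
      using Suc block \<theta> by (intro mult_mono) auto
    finally show ?case by (simp add: mult.commute)
  qed (simp add: mat_norm_mat_1)
  have "mat_norm (matprod A (n div l * l + n mod l))
      \<le> mat_norm (matprod A (n div l * l))
        * mat_norm (matprod (\<lambda>i. A (n div l * l + i)) (n mod l))"
    unfolding matprod_add by (rule mat_norm_mult_le)
  also have "\<dots> \<le> \<theta> ^ (n div l) * 1"
    using blocks A \<theta> by (intro mult_mono mat_norm_matprod_le_1) auto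
  finally show ?thesis by simp
qed

text \<open>Turns the staircase bound into a geometric one: \<open>n div l\<close> is at least
  \<open>n / l - 1\<close>, and the lost unit in the exponent costs
  \<open>inverse \<theta>\<close>.\<close>

lemma power_div_le_geometric:
  fixes \<theta> :: real
  assumes "0 < \<theta>" "\<theta> < 1" "l \<ge> 1"
  shows "\<theta> ^ (n div l) \<le> inverse \<theta> * (\<theta> powr (1 / real l)) ^ n"
proof -
  have "real n = real (n div l) * real l + real (n mod l)"
    by (metis div_mult_mod_eq of_nat_add of_nat_mult)
  also have "\<dots> \<le> (real (n div l) + 1) * real l"
    using assms(3) by (simp add: algebra_simps)
  finally have "real n / real l - 1 \<le> real (n div l)"
    using assms(3) by (simp add: field_simps)
  then have "\<theta> powr real (n div l) \<le> \<theta> powr (real n / real l - 1)"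
    using assms by (intro powr_mono') auto
  also have "\<dots> = inverse \<theta> * (\<theta> powr (1 / real l)) ^ n"
    using assms by (simp add: powr_diff powr_powr divide_inverse mult.commute flip: powr_realpow)
  finally show ?thesis
    using assms by (simp add: powr_realpow)
qed

text \<open>Iterates \<open>g j = d j + A (Suc j) *v g (Suc j)\<close>, where \<open>d j\<close> is
  whatever the difference happens to be; no relation between \<open>g\<close> and \<open>A\<close>
  is assumed.\<close>

lemma matprod_telescope:
  "g 0 = (\<Sum>j<n. matprod A j *v (g j - A (Suc j) *v g (Suc j))) + matprod A n *v g n"
  by (induction n) (simp_all add: matrix_vector_mult_diff_distrib matrix_vector_mul_assoc)

text \<open>Telescoping writes \<open>v \<bullet> g 0\<close> as the first \<open>n\<close> terms of
  the series, plus the weighted defects, plus a remainder in \<open>g n\<close>. The defects cost at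
  most \<open>n * D\<close>; the series tail and the remainder both carry the factor
  \<open>K * \<rho> ^ n\<close>.\<close>

lemma abs_suminf_matprod_diff_le:
  fixes A :: "nat \<Rightarrow> real ^ 's ^ 's::finite"
  assumes v: "(\<Sum>x\<in>UNIV. \<bar>v $ x\<bar>) \<le> 1"
    and A: "\<And>k. k \<ge> 1 \<Longrightarrow> mat_norm (A k) \<le> 1"
    and decay: "\<And>j. mat_norm (matprod A j) \<le> K * \<rho> ^ j"
    and \<rho>: "0 \<le> \<rho>" "\<rho> < 1"
    and f: "\<And>j. infnorm (f j) \<le> F"
    and defect: "\<And>j. j < n \<Longrightarrow> infnorm (g j - (f j + A (Suc j) *v g (Suc j))) \<le> D"
  shows "\<bar>(\<Sum>j. (v v* matprod A j) \<bullet> f j) - v \<bullet> g 0\<bar>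
      \<le> real n * D + K * \<rho> ^ n * (F / (1 - \<rho>) + infnorm (g n))"
proof -
  let ?t = "\<lambda>j. (v v* matprod A j) \<bullet> f j"
  have vx: "\<bar>v \<bullet> x\<bar> \<le> infnorm x" for x
    using abs_inner_le_infnorm[of v x] v mult_right_mono[OF v infnorm_pos_le[of x]] by simp
  have F: "0 \<le> F"
    by (rule order_trans[OF infnorm_pos_le f])
  have K: "0 \<le> K * \<rho> ^ j" for j
    by (rule order_trans[OF mat_norm_nonneg decay])
  have decay_mult: "infnorm (matprod A j *v x) \<le> K * \<rho> ^ j * infnorm x" for j x
    by (rule order_trans[OF infnorm_matrix_vector_mult_le mult_right_mono[OF decay infnorm_pos_le]])
  have t_le: "\<bar>?t j\<bar> \<le> K * F * \<rho> ^ j" for j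
  proof -
    have "\<bar>?t j\<bar> \<le> infnorm (matprod A j *v f j)"
      unfolding dot_lmul_matrix by (rule vx)
    also have "\<dots> \<le> K * \<rho> ^ j * infnorm (f j)"
      by (rule decay_mult)
    also have "\<dots> \<le> K * \<rho> ^ j * F"
      by (intro mult_left_mono f K)
    finally show ?thesis by (simp add: mult_ac)
  qed
  have geo: "(\<lambda>j. K * F * \<rho> ^ n * \<rho> ^ j) sums (K * F * \<rho> ^ n * (1 / (1 - \<rho>)))"
    using \<rho> by (intro sums_mult geometric_sums) simp
  have "summable ?t"
    by (rule summable_comparison_test'[where g = "\<lambda>j. K * F * \<rho> ^ j" and N = 0])
      (use t_le \<rho> in \<open>auto intro!: summable_mult summable_geometric\<close>)
  then have split: "(\<Sum>j. ?t j) = (\<Sum>j. ?t (j + n)) + (\<Sum>j<n. ?t j)"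
    by (rule suminf_split_initial_segment)
  have tail_le: "\<bar>?t (j + n)\<bar> \<le> K * F * \<rho> ^ n * \<rho> ^ j" for j
    using t_le[of "j + n"] by (simp add: power_add mult_ac)
  have tail: "\<bar>\<Sum>j. ?t (j + n)\<bar> \<le> K * \<rho> ^ n * (F / (1 - \<rho>))"
  proof -
    have "summable (\<lambda>j. \<bar>?t (j + n)\<bar>)"
      using tail_le by (intro summable_comparison_test'[OF sums_summable[OF geo]]) auto
    then have "\<bar>\<Sum>j. ?t (j + n)\<bar> \<le> (\<Sum>j. \<bar>?t (j + n)\<bar>)"
      by (rule summable_rabs)
    also have "\<dots> \<le> (\<Sum>j. K * F * \<rho> ^ n * \<rho> ^ j)"
      using \<open>summable (\<lambda>j. \<bar>?t (j + n)\<bar>)\<close> tail_le sums_summable[OF geo] by (intro suminf_le) auto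
    finally show ?thesis
      using sums_unique[OF geo] by (simp add: mult_ac)
  qed
  define h where "h j = g j - (f j + A (Suc j) *v g (Suc j))" for j
  have "v \<bullet> g 0 = (\<Sum>j<n. v \<bullet> (matprod A j *v (f j + h j))) + v \<bullet> (matprod A n *v g n)"
    by (subst matprod_telescope[of g A n]) (simp add: h_def inner_add_right inner_sum_right)
  also have "\<dots> = (\<Sum>j<n. ?t j) + (\<Sum>j<n. v \<bullet> (matprod A j *v h j)) + v \<bullet> (matprod A n *v g n)"
    by (simp add: dot_lmul_matrix matrix_vector_right_distrib inner_add_right sum.distrib)
  finally have eq: "(\<Sum>j. ?t j) - v \<bullet> g 0
      = (\<Sum>j. ?t (j + n)) - (\<Sum>j<n. v \<bullet> (matprod A j *v h j)) - v \<bullet> (matprod A n *v g n)"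
    using split by simp
  have "\<bar>\<Sum>j<n. v \<bullet> (matprod A j *v h j)\<bar> \<le> (\<Sum>j<n. D)"
  proof (rule order_trans[OF sum_abs sum_mono])
    fix j assume "j \<in> {..<n}"
    have "\<bar>v \<bullet> (matprod A j *v h j)\<bar> \<le> mat_norm (matprod A j) * infnorm (h j)"
      by (rule order_trans[OF vx infnorm_matrix_vector_mult_le])
    \<comment> \<open>The crude bound 1 on the product suffices here: summing over \<open>j\<close>
      then costs a factor \<open>n\<close>, which in the application is only a power of a
      logarithm.\<close>
    also have "\<dots> \<le> 1 * infnorm (h j)"
      using A by (intro mult_right_mono mat_norm_matprod_le_1 infnorm_pos_le) auto
    also have "\<dots> \<le> D"
      using defect \<open>j \<in> {..<n}\<close> by (simp add: h_def)
    finally show "\<bar>v \<bullet> (matprod A j *v h j)\<bar> \<le> D" .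
  qed
  moreover have "\<bar>v \<bullet> (matprod A n *v g n)\<bar> \<le> K * \<rho> ^ n * infnorm (g n)"
    by (rule order_trans[OF vx decay_mult])
  ultimately show ?thesis
    using tail unfolding eq distrib_left by (simp add: algebra_simps)
qed

section \<open>Triviality of the kernel of \<open>I - B\<close>\<close>

text \<open>Telescope the constant sequence \<open>x\<close> along a product of \<open>l\<close>
  matrices close to \<open>B\<close>. Each defect is small because \<open>B\<close> fixes
  \<open>x\<close>, and the remainder is at most \<theta> times the norm of \<open>x\<close>.
  Letting the closeness tend to 0 leaves \<open>(1 - \<theta>) * infnorm x \<le> 0\<close>.\<close>

lemma fixed_vector_eq_0_of_approximation:
  fixes B :: "real ^ 's ^ 's::finite"
  assumes fixed: "B *v x = x" and "\<theta> < 1"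
    and approx: "\<And>\<eta>. \<eta> > 0 \<Longrightarrow> \<exists>A. (\<forall>k\<ge>1. mat_norm (A k) \<le> 1) \<and>
      (\<forall>k\<in>{1..l}. mat_norm (A k - B) \<le> \<eta>) \<and> mat_norm (matprod A l) \<le> \<theta>"
  shows "x = 0"
proof -
  have "(1 - \<theta>) * infnorm x \<le> 0 + \<eta>" if "\<eta> > 0" for \<eta>
  proof -
    \<comment> \<open>Chosen so that \<open>l\<close> defects of size
      \<open>\<eta>' * infnorm x\<close> sum to at most \<eta>; the \<open>+ 1\<close> keeps the
      denominator positive when \<open>x = 0\<close>.\<close>
    define \<eta>' where "\<eta>' = \<eta> / (real l * infnorm x + 1)"
    have pos: "0 < real l * infnorm x + 1"
      by (simp add: add_nonneg_pos infnorm_pos_le)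
    then have "\<eta>' > 0"
      using that by (simp add: \<eta>'_def)
    then obtain A where A: "\<And>k. k \<ge> 1 \<Longrightarrow> mat_norm (A k) \<le> 1"
      "\<And>k. k \<in> {1..l} \<Longrightarrow> mat_norm (A k - B) \<le> \<eta>'" "mat_norm (matprod A l) \<le> \<theta>"
      using approx by meson
    have step: "infnorm (matprod A j *v (x - A (Suc j) *v x)) \<le> \<eta>' * infnorm x" if "j < l" for j
    proof -
      have "x - A (Suc j) *v x = - ((A (Suc j) - B) *v x)"
        using fixed by (simp add: matrix_vector_mult_diff_rdistrib)
      then have "infnorm (x - A (Suc j) *v x) \<le> mat_norm (A (Suc j) - B) * infnorm x"
        using infnorm_matrix_vector_mult_le[of "A (Suc j) - B" x] by (simp add: infnorm_neg)
      also have "\<dots> \<le> \<eta>' * infnorm x"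
        using A(2) that by (intro mult_right_mono infnorm_pos_le) auto
      finally have le: "infnorm (x - A (Suc j) *v x) \<le> \<eta>' * infnorm x" .
      have "infnorm (matprod A j *v (x - A (Suc j) *v x)) \<le> 1 * infnorm (x - A (Suc j) *v x)"
        using A(1) by (intro order_trans[OF infnorm_matrix_vector_mult_le] mult_right_mono
            mat_norm_matprod_le_1 infnorm_pos_le)
      then show ?thesis using le by simp
    qed
    have "infnorm x = infnorm ((\<Sum>j<l. matprod A j *v (x - A (Suc j) *v x)) + matprod A l *v x)"
      using matprod_telescope[of "\<lambda>_. x" A l] by simp
    also have "\<dots> \<le> (\<Sum>j<l. infnorm (matprod A j *v (x - A (Suc j) *v x))) + infnorm (matprod A l *v x)"
      by (intro order_trans[OF infnorm_triangle] add_mono infnorm_sum_le order_refl)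
    also have "\<dots> \<le> (\<Sum>j<l. \<eta>' * infnorm x) + mat_norm (matprod A l) * infnorm x"
      using step by (intro add_mono sum_mono infnorm_matrix_vector_mult_le) auto
    also have "\<dots> \<le> real l * (\<eta>' * infnorm x) + \<theta> * infnorm x"
      using A(3) by (simp add: mult_right_mono infnorm_pos_le)
    finally have "(1 - \<theta>) * infnorm x \<le> \<eta>' * (real l * infnorm x)"
      by (simp add: algebra_simps)
    also have "\<dots> \<le> \<eta>' * (real l * infnorm x + 1)"
      using \<open>\<eta>' > 0\<close> by (intro mult_left_mono) auto
    also have "\<dots> = \<eta>"
      using pos by (simp add: \<eta>'_def)
    finally show ?thesis by simp
  qed
  then have "(1 - \<theta>) * infnorm x \<le> 0"
    by (rule field_le_epsilon)
  then have "infnorm x \<le> 0"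
    using \<open>\<theta> < 1\<close> by (simp add: mult_le_0_iff)
  then show ?thesis
    using infnorm_pos_lt[of x] by linarith
qed

lemma invertible_iff_kernel_trivial:
  fixes A :: "real ^ 'n ^ 'n::finite"
  shows "invertible A \<longleftrightarrow> (\<forall>x. A *v x = 0 \<longrightarrow> x = 0)"
  using invertible_left_inverse[of A] matrix_left_invertible_ker[of A] by simp

section \<open>The defect of the first-order ansatz\<close>

text \<open>The equations for \<open>a\<close>, \<open>b\<close>, \<open>c\<close> cancel the terms
  of size 1, \<open>\<epsilon> k\<close> and \<epsilon>; the \<open>B b\<close> in the equation for
  \<open>c\<close> comes from the shift from \<open>k\<close> to \<open>k + 1\<close>. What survives
  is the product of the two first-order perturbations, of order
  \<open>\<epsilon>\<^sup>2 \<Lambda>\<^sup>2\<close>, and the terms containing \<open>E\<close>.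
  The condition \<open>\<epsilon> * \<Lambda> \<le> 1\<close> bounds \<open>g\<close>
  uniformly.\<close>

lemma affine_value_defect_le:
  fixes C :: "'s::finite set" and Pt Pt1 E :: "real ^ 's ^ 's"
  assumes a: "a = step_reward C r Pt + restrict_mat C Pt *v a"
    and b: "b = exit_reward C r Pt1 + restrict_mat C Pt1 *v a + restrict_mat C Pt *v b"
    and c: "c = restrict_mat C Pt *v b + restrict_mat C Pt *v c"
    and Q: "Q = Pt + (\<epsilon> * real k) *\<^sub>R Pt1 + E"
    and g: "\<And>j. g j = a + (\<epsilon> * real j) *\<^sub>R b + \<epsilon> *\<^sub>R c"
    and \<epsilon>: "0 \<le> \<epsilon>" and k: "real (Suc k) \<le> \<Lambda>" and \<epsilon>\<Lambda>: "\<epsilon> * \<Lambda> \<le> 1"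
  shows "infnorm (g k - (step_reward C r Q + restrict_mat C Q *v g (Suc k)))
    \<le> \<epsilon>\<^sup>2 * \<Lambda>\<^sup>2 * (mat_norm Pt1 * (infnorm b + infnorm c))
      + mat_norm E * (infnorm r + infnorm a + infnorm b + infnorm c)"
    and "infnorm (g (Suc k)) \<le> infnorm a + infnorm b + infnorm c"
proof -
  let ?B = "restrict_mat C Pt" and ?B1 = "restrict_mat C Pt1" and ?E = "restrict_mat C E"
  let ?d = "real (Suc k) *\<^sub>R b + c"
  have \<Lambda>: "1 \<le> \<Lambda>"
    using k by simp
  have "\<epsilon> * 1 \<le> \<epsilon> * \<Lambda>" and "\<epsilon> * real (Suc k) \<le> \<epsilon> * \<Lambda>"
    by (rule mult_left_mono[OF _ \<epsilon>], fact)+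
  then have le1: "\<epsilon> \<le> 1" "\<epsilon> * real (Suc k) \<le> 1"
    using \<epsilon>\<Lambda> by linarith+
  have gS: "g (Suc k) = a + \<epsilon> *\<^sub>R ?d"
    by (simp add: g scaleR_right_distrib)
  \<comment> \<open>Sorted by order in \<epsilon>: the first three brackets vanish by the equations
    for \<open>a\<close>, \<open>b\<close> and \<open>c\<close>.\<close>
  have "g k - (step_reward C r Q + restrict_mat C Q *v g (Suc k))
    = (a - (step_reward C r Pt + ?B *v a))
      + (\<epsilon> * real k) *\<^sub>R (b - (exit_reward C r Pt1 + ?B1 *v a + ?B *v b))
      + \<epsilon> *\<^sub>R (c - (?B *v b + ?B *v c))
      - ((\<epsilon>\<^sup>2 * real k) *\<^sub>R (?B1 *v ?d) + exit_reward C r E + ?E *v g (Suc k))"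
    unfolding gS g[of k] Q step_reward_eq restrict_mat_add restrict_mat_scaleR
      exit_reward_add exit_reward_scaleR
    by (simp add: matrix_vector_mult_add_rdistrib matrix_vector_right_distrib
        matrix_vector_mult_scaleR scaleR_matrix_vector_assoc[symmetric]
        algebra_simps power2_eq_square)
  also have "\<dots> = - ((\<epsilon>\<^sup>2 * real k) *\<^sub>R (?B1 *v ?d) + exit_reward C r E + ?E *v g (Suc k))"
    using a b c by simp
  finally have "infnorm (g k - (step_reward C r Q + restrict_mat C Q *v g (Suc k)))
    = infnorm ((\<epsilon>\<^sup>2 * real k) *\<^sub>R (?B1 *v ?d) + exit_reward C r E + ?E *v g (Suc k))"
    by (simp only: infnorm_neg)
  also have "\<dots> \<le> infnorm ((\<epsilon>\<^sup>2 * real k) *\<^sub>R (?B1 *v ?d)) + infnorm (exit_reward C r E)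
      + infnorm (?E *v g (Suc k))"
    by (intro order_trans[OF infnorm_triangle] add_mono infnorm_triangle order_refl)
  finally have main: "infnorm (g k - (step_reward C r Q + restrict_mat C Q *v g (Suc k))) \<le> \<dots>" .
  show gS_le: "infnorm (g (Suc k)) \<le> infnorm a + infnorm b + infnorm c"
  proof -
    have "infnorm (g (Suc k)) \<le> infnorm a + infnorm ((\<epsilon> * real (Suc k)) *\<^sub>R b) + infnorm (\<epsilon> *\<^sub>R c)"
      unfolding g by (intro order_trans[OF infnorm_triangle] add_mono infnorm_triangle order_refl)
    also have "\<dots> \<le> infnorm a + 1 * infnorm b + 1 * infnorm c"
      unfolding infnorm_scaleR using \<epsilon> le1
      by (intro add_mono mult_right_mono infnorm_pos_le order_refl) auto
    finally show ?thesis by simp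
  qed
  have "infnorm ?d \<le> infnorm (real (Suc k) *\<^sub>R b) + infnorm c"
    by (rule infnorm_triangle)
  also have "\<dots> \<le> \<Lambda> * infnorm b + \<Lambda> * infnorm c"
    unfolding infnorm_scaleR using k \<Lambda> mult_right_mono[OF \<Lambda> infnorm_pos_le[of c]]
    by (intro add_mono mult_right_mono infnorm_pos_le) auto
  finally have d_le: "infnorm ?d \<le> \<Lambda> * (infnorm b + infnorm c)"
    by (simp add: distrib_left)
  have "infnorm ((\<epsilon>\<^sup>2 * real k) *\<^sub>R (?B1 *v ?d)) = \<epsilon>\<^sup>2 * real k * infnorm (?B1 *v ?d)"
    by (simp add: infnorm_scaleR)
  also have "\<dots> \<le> \<epsilon>\<^sup>2 * \<Lambda> * (mat_norm Pt1 * (\<Lambda> * (infnorm b + infnorm c)))"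
  proof (intro mult_mono)
    have "infnorm (?B1 *v ?d) \<le> mat_norm ?B1 * infnorm ?d"
      by (rule infnorm_matrix_vector_mult_le)
    also have "\<dots> \<le> mat_norm Pt1 * (\<Lambda> * (infnorm b + infnorm c))"
      by (intro mult_mono mat_norm_restrict_mat_le d_le infnorm_pos_le mat_norm_nonneg)
    finally show "infnorm (?B1 *v ?d) \<le> mat_norm Pt1 * (\<Lambda> * (infnorm b + infnorm c))" .
  qed (use k \<Lambda> in \<open>auto simp: infnorm_pos_le\<close>)
  also have "\<dots> = \<epsilon>\<^sup>2 * \<Lambda>\<^sup>2 * (mat_norm Pt1 * (infnorm b + infnorm c))"
    by (simp add: power2_eq_square mult_ac)
  finally have 1: "infnorm ((\<epsilon>\<^sup>2 * real k) *\<^sub>R (?B1 *v ?d)) \<le> \<dots>" .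
  have "infnorm (?E *v g (Suc k)) \<le> mat_norm ?E * infnorm (g (Suc k))"
    by (rule infnorm_matrix_vector_mult_le)
  also have "\<dots> \<le> mat_norm E * (infnorm a + infnorm b + infnorm c)"
    by (intro mult_mono mat_norm_restrict_mat_le gS_le infnorm_pos_le mat_norm_nonneg)
  finally show "infnorm (g k - (step_reward C r Q + restrict_mat C Q *v g (Suc k)))
    \<le> \<epsilon>\<^sup>2 * \<Lambda>\<^sup>2 * (mat_norm Pt1 * (infnorm b + infnorm c))
      + mat_norm E * (infnorm r + infnorm a + infnorm b + infnorm c)"
    using main 1 infnorm_exit_reward_le[of C r E] by (simp add: algebra_simps)
qed

text \<open>With \<open>L = ln (1 / \<epsilon>)\<close>, the left side is
  \<open>exp (- \<bar>ln \<rho>\<bar> * L powr \<gamma> * L)\<close>. Since \<gamma> is positive,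
  \<open>\<bar>ln \<rho>\<bar> * L powr \<gamma>\<close> eventually exceeds 2, and
  \<open>exp (- 2 * L)\<close> is the square of \<epsilon>.\<close>

lemma eventually_geometric_le_square:
  fixes \<rho> \<gamma> :: real
  assumes "0 < \<rho>" "\<rho> < 1" "\<gamma> > 0"
  shows "\<forall>\<^sub>F \<epsilon> in at_right 0. \<rho> powr (ln (1 / \<epsilon>) powr (1 + \<gamma>)) \<le> \<epsilon>\<^sup>2"
proof -
  have "filterlim (\<lambda>\<epsilon>::real. ln (1 / \<epsilon>) powr \<gamma>) at_top (at_right 0)"
    using \<open>\<gamma> > 0\<close> by real_asymp
  then have 1: "\<forall>\<^sub>F \<epsilon> in at_right 0. 2 / - ln \<rho> \<le> ln (1 / \<epsilon>) powr \<gamma>"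
    by (simp add: filterlim_at_top)
  have 2: "\<forall>\<^sub>F \<epsilon>::real in at_right 0. 0 < \<epsilon>"
    by real_asymp
  have 3: "\<forall>\<^sub>F \<epsilon>::real in at_right 0. 1 \<le> ln (1 / \<epsilon>)"
    by real_asymp
  show ?thesis
    using 1 2 3
  proof eventually_elim
    case (elim \<epsilon>)
    let ?L = "ln (1 / \<epsilon>)"
    have "2 \<le> - ln \<rho> * ?L powr \<gamma>"
      using elim(1) assms by (simp add: divide_simps mult.commute split: if_splits)
    then have "2 * ?L \<le> - ln \<rho> * ?L powr \<gamma> * ?L"
      using elim(3) by (intro mult_right_mono) auto
    also have "\<dots> = - ln \<rho> * ?L powr (1 + \<gamma>)"
      using elim(3) by (simp add: powr_add)
    finally have "?L powr (1 + \<gamma>) * ln \<rho> \<le> 2 * ln \<epsilon>"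
      using elim(2) by (simp add: ln_div mult.commute)
    also have "\<dots> = ln (\<epsilon>\<^sup>2)"
      using elim(2) by (simp add: ln_realpow)
    finally have "exp (?L powr (1 + \<gamma>) * ln \<rho>) \<le> exp (ln (\<epsilon>\<^sup>2))"
      by simp
    then show ?case
      using assms elim(2) by (simp add: powr_def)
  qed
qed

section \<open>The expansion of the cumulated reward\<close>

theorem theorem3:
  fixes C :: "'s::finite set"
    and \<mu> r :: "real ^ 's"
    and P :: "nat \<Rightarrow> real \<Rightarrow> real ^ 's ^ 's"
    and Pt Pt1 :: "real ^ 's ^ 's"
    and l :: nat
    and s \<gamma> :: real
  assumes "prob_vec \<mu>"
    and "\<And>k \<epsilon>. k \<ge> 1 \<Longrightarrow> \<epsilon> > 0 \<Longrightarrow> stochastic (P k \<epsilon>)"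
    and "l \<ge> 1" and "s > 0" and "\<gamma> > 0"
    and "(\<lambda>\<epsilon>. SUP i\<in>{i. 1 \<le> i \<and> real i \<le> ln (1 / \<epsilon>) powr (1 + \<gamma>)}.
             mat_norm (P i \<epsilon> - (Pt + (\<epsilon> * (real i - 1)) *\<^sub>R Pt1)))
           \<in> O[at_right 0](\<lambda>\<epsilon>. \<epsilon> ^ 2 * ln (1 / \<epsilon>) powr s)"
    and "(SUP (k, \<epsilon>)\<in>UNIV \<times> {0<..}.
             mat_norm (matprod (\<lambda>i. restrict_mat C (P (k + i) \<epsilon>)) l)) < 1"
  shows "\<exists>w::real.
    let m = restrict_vec C \<mu>;
        B = restrict_mat C Pt;
        B1 = restrict_mat C Pt1;
        N = matrix_inv (mat 1 - B);
        rt = step_reward C r Pt;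
        rt1 = exit_reward C r Pt1
    in (\<lambda>\<epsilon>. cumulated_reward C \<mu> r P \<epsilon>
          - ((m v* N) \<bullet> rt
             + \<epsilon> * ((m v* (B ** N ** N ** B1 ** N)) \<bullet> rt)
             + \<epsilon> * ((m v* (B ** N ** N)) \<bullet> rt1)))
       \<in> O[at_right 0](\<lambda>\<epsilon>. \<epsilon> ^ 2 * ln (1 / \<epsilon>) powr w)"
proof -
  define B where "B = restrict_mat C Pt"
  define B1 where "B1 = restrict_mat C Pt1"
  define N where "N = matrix_inv (mat 1 - B)"
  define m where "m = restrict_vec C \<mu>"
  define rt where "rt = step_reward C r Pt"
  define rt1 where "rt1 = exit_reward C r Pt1"
  define A where "A \<epsilon> k = restrict_mat C (P k \<epsilon>)" for \<epsilon> k
  \<comment> \<open>The error of the affine approximation. It is controlled only for indices up to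
    \<open>\<Lambda> \<epsilon>\<close>, which limits the number of telescoping steps.\<close>
  define E where "E \<epsilon> k = P k \<epsilon> - (Pt + (\<epsilon> * (real k - 1)) *\<^sub>R Pt1)" for \<epsilon> k
  define \<Lambda> where "\<Lambda> \<epsilon> = ln (1 / \<epsilon>) powr (1 + \<gamma>)" for \<epsilon> :: real
  note stoch = assms(2) and \<gamma> = \<open>\<gamma> > 0\<close>

  \<comment> \<open>Geometric decay of the products, uniformly in \<epsilon>\<close>
  have A_le: "mat_norm (A \<epsilon> k) \<le> 1" if "\<epsilon> > 0" "k \<ge> 1" for \<epsilon> k
    unfolding A_def
    using order_trans[OF mat_norm_restrict_mat_le mat_norm_stochastic] stoch that by blast

  define \<theta>0 where "\<theta>0 = (SUP (k, \<epsilon>)\<in>UNIV \<times> {0<..}. mat_norm (matprod (\<lambda>i. A \<epsilon> (k + i)) l))"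
  have "\<theta>0 < 1"
    using assms(7) by (simp add: \<theta>0_def A_def)
  have "mat_norm (matprod (\<lambda>i. A \<epsilon> (k + i)) l) \<le> \<theta>0" if "\<epsilon> > 0" for \<epsilon> k
  proof -
    \<comment> \<open>A real supremum dominates its members only if the set is bounded above;
      substochasticity gives the bound 1.\<close>
    have "bdd_above ((\<lambda>(k, \<epsilon>). mat_norm (matprod (\<lambda>i. A \<epsilon> (k + i)) l)) ` (UNIV \<times> {0<..}))"
      by (rule bdd_aboveI[of _ 1]) (auto intro!: mat_norm_matprod_le_1 A_le)
    from cSUP_upper[OF _ this, of "(k, \<epsilon>)"] that show ?thesis
      by (simp add: \<theta>0_def)
  qed
  \<comment> \<open>The maximum with \<open>1 / 2\<close> makes \<theta> positive, as
    \<open>inverse \<theta>\<close> and the root defining \<rho> require.\<close>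
  moreover define \<theta> where "\<theta> = max \<theta>0 (1 / 2)"
  ultimately have block: "mat_norm (matprod (\<lambda>i. A \<epsilon> (k + i)) l) \<le> \<theta>" if "\<epsilon> > 0" for \<epsilon> k
    using that by (meson max.coboundedI1)
  have \<theta>: "0 < \<theta>" "\<theta> < 1"
    using \<open>\<theta>0 < 1\<close> by (auto simp: \<theta>_def)
  define \<rho> where "\<rho> = \<theta> powr (1 / real l)"
  have \<rho>: "0 < \<rho>" "\<rho> < 1"
    using \<theta> \<open>l \<ge> 1\<close> by (simp_all add: \<rho>_def powr01_less_one)
  have decay: "mat_norm (matprod (A \<epsilon>) j) \<le> inverse \<theta> * \<rho> ^ j" if "\<epsilon> > 0" for \<epsilon> j
    using order_trans[OF mat_norm_matprod_le_power power_div_le_geometric[OF \<theta> \<open>l \<ge> 1\<close>]]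
      A_le block that unfolding \<rho>_def by metis

  \<comment> \<open>Pointwise bounds on the approximation error\<close>
  obtain c0 where "c0 > 0" and c0: "\<forall>\<^sub>F \<epsilon> in at_right 0.
      norm (SUP i\<in>{i. 1 \<le> i \<and> real i \<le> \<Lambda> \<epsilon>}. mat_norm (E \<epsilon> i))
        \<le> c0 * norm (\<epsilon> ^ 2 * ln (1 / \<epsilon>) powr s)"
    using assms(6) unfolding E_def \<Lambda>_def by (rule landau_o.bigE)
  have E_le: "\<forall>\<^sub>F \<epsilon> in at_right 0. \<forall>i. 1 \<le> i \<and> real i \<le> \<Lambda> \<epsilon> \<longrightarrow>
      mat_norm (E \<epsilon> i) \<le> c0 * (\<epsilon> ^ 2 * ln (1 / \<epsilon>) powr s)"
    using c0
  proof eventually_elim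
    case (elim \<epsilon>)
    let ?I = "{i. 1 \<le> i \<and> real i \<le> \<Lambda> \<epsilon>}"
    \<comment> \<open>Finiteness of the index set is what lets the real supremum bound each single
      error.\<close>
    have "?I \<subseteq> {..nat \<lfloor>\<Lambda> \<epsilon>\<rfloor>}"
      by (auto simp: le_nat_floor)
    then have "finite ?I"
      by (rule finite_subset) simp
    then have "mat_norm (E \<epsilon> i) \<le> (SUP i\<in>?I. mat_norm (E \<epsilon> i))" if "i \<in> ?I" for i
      using that by (intro cSUP_upper bdd_above_finite) auto
    with elim show ?case
      by (force simp: abs_mult)
  qed

  have pos: "\<forall>\<^sub>F \<epsilon>::real in at_right 0. 0 < \<epsilon>"
    by real_asymp
  have L_ge: "\<forall>\<^sub>F \<epsilon>::real in at_right 0. 1 \<le> ln (1 / \<epsilon>)"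
    by real_asymp

  \<comment> \<open>Invertibility of \<open>I - B\<close>\<close>
  have "invertible (mat 1 - B)"
    unfolding invertible_iff_kernel_trivial
  proof (intro allI impI)
    fix x assume "(mat 1 - B) *v x = 0"
    then have "B *v x = x"
      by (simp add: matrix_vector_mult_diff_rdistrib)
    then show "x = 0"
    proof (rule fixed_vector_eq_0_of_approximation[OF _ \<theta>(2)])
      fix \<eta> :: real assume "\<eta> > 0"
      \<comment> \<open>For fixed \<open>l\<close>, both the error and the drift of the first
        \<open>l\<close> matrices vanish with \<epsilon>, so a single small \<epsilon> supplies the
        approximating sequence.\<close>
      have "((\<lambda>\<epsilon>. c0 * (\<epsilon> ^ 2 * ln (1 / \<epsilon>) powr s) + \<epsilon> * (real l * mat_norm Pt1)) \<longlongrightarrow> 0) (at_right 0)"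
        by real_asymp
      then have small: "\<forall>\<^sub>F \<epsilon> in at_right 0.
          c0 * (\<epsilon> ^ 2 * ln (1 / \<epsilon>) powr s) + \<epsilon> * (real l * mat_norm Pt1) < \<eta>"
        using \<open>\<eta> > 0\<close> by (rule order_tendstoD)
      have large: "\<forall>\<^sub>F \<epsilon> in at_right 0. real l \<le> \<Lambda> \<epsilon>"
        unfolding \<Lambda>_def using \<gamma> by real_asymp
      have "\<forall>\<^sub>F \<epsilon> in at_right 0. 0 < \<epsilon> \<and> (\<forall>k\<in>{1..l}. mat_norm (A \<epsilon> k - B) \<le> \<eta>)"
        using E_le pos small large
      proof eventually_elim
        case (elim \<epsilon>)
        have "mat_norm (A \<epsilon> k - B) \<le> \<eta>" if k: "k \<in> {1..l}" for k
        proof -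
          have "A \<epsilon> k - B = restrict_mat C (E \<epsilon> k + (\<epsilon> * (real k - 1)) *\<^sub>R Pt1)"
            by (simp add: A_def B_def E_def restrict_mat_def vec_eq_iff)
          then have "mat_norm (A \<epsilon> k - B) \<le> mat_norm (E \<epsilon> k + (\<epsilon> * (real k - 1)) *\<^sub>R Pt1)"
            by (simp add: mat_norm_restrict_mat_le)
          also have "\<dots> \<le> mat_norm (E \<epsilon> k) + \<bar>\<epsilon> * (real k - 1)\<bar> * mat_norm Pt1"
            by (intro order_trans[OF mat_norm_triangle] add_mono mat_norm_scaleR order_refl)
          also have "\<dots> \<le> c0 * (\<epsilon> ^ 2 * ln (1 / \<epsilon>) powr s) + \<epsilon> * real l * mat_norm Pt1"
            using elim k by (intro add_mono mult_right_mono) (auto simp: abs_mult)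
          finally show ?thesis using elim by (simp add: mult.assoc)
        qed
        with elim show ?case by blast
      qed
      then obtain \<epsilon> where "0 < \<epsilon>" "\<forall>k\<in>{1..l}. mat_norm (A \<epsilon> k - B) \<le> \<eta>"
        using eventually_happens'[OF trivial_limit_at_right_real] by blast
      then show "\<exists>A. (\<forall>k\<ge>1. mat_norm (A k) \<le> 1) \<and> (\<forall>k\<in>{1..l}. mat_norm (A k - B) \<le> \<eta>) \<and>
          mat_norm (matprod A l) \<le> \<theta>"
        using A_le block[of \<epsilon> 0] by (intro exI[of _ "A \<epsilon>"]) auto
    qed
  qed
  then have "(mat 1 - B) ** N = mat 1"
    unfolding N_def matrix_inv_def invertible_def by (rule someI2_ex) (rule conjunct1)
  \<comment> \<open>\<open>N *v x\<close> solves \<open>y = x + B *v y\<close>, the form of the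
    equations for \<open>a\<close> and \<open>b\<close>.\<close>
  then have N: "N *v x = x + B *v (N *v x)" for x
    by (metis (no_types) matrix_vector_mul_assoc matrix_vector_mul_lid matrix_vector_mult_diff_rdistrib
        diff_add_cancel)

  \<comment> \<open>The coefficients of the ansatz\<close>
  define a where "a = N *v rt"
  define b where "b = N *v (rt1 + B1 *v a)"
  define c where "c = B *v (N *v b)"
  define g where "g \<epsilon> j = a + (\<epsilon> * real j) *\<^sub>R b + \<epsilon> *\<^sub>R c" for \<epsilon> j
  have a: "a = rt + B *v a"
    unfolding a_def by (rule N)
  have b: "b = rt1 + B1 *v a + B *v b"
    unfolding b_def by (rule N)
  have c: "c = B *v b + B *v c"
    unfolding c_def by (subst N) (simp only: matrix_vector_right_distrib)
  \<comment> \<open>At index 0 the term in \<open>b\<close> drops out, and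
    \<open>c = B N N (rt1 + B1 N rt)\<close> yields both first-order terms of the claim.\<close>
  have expansion: "(m v* N) \<bullet> rt + \<epsilon> * ((m v* (B ** N ** N ** B1 ** N)) \<bullet> rt)
      + \<epsilon> * ((m v* (B ** N ** N)) \<bullet> rt1) = m \<bullet> g \<epsilon> 0" for \<epsilon>
    by (simp add: g_def c_def b_def a_def dot_lmul_matrix matrix_vector_mul_assoc[symmetric]
        matrix_vector_right_distrib inner_add_right distrib_left)

  have m: "(\<Sum>x\<in>UNIV. \<bar>m $ x\<bar>) \<le> 1"
  proof -
    have "(\<Sum>x\<in>UNIV. \<bar>m $ x\<bar>) \<le> (\<Sum>x\<in>UNIV. \<mu> $ x)"
      using assms(1) by (intro sum_mono) (simp add: m_def restrict_vec_def prob_vec_def)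
    then show ?thesis
      using assms(1) by (simp add: prob_vec_def)
  qed

  \<comment> \<open>The error estimate\<close>
  define G where "G = infnorm a + infnorm b + infnorm c"
  define H where "H = mat_norm Pt1 * (infnorm b + infnorm c)"
  define F where "F = 2 * infnorm r"
  define K where "K = H + c0 * (infnorm r + G) + inverse \<theta> * inverse \<rho> * (F / (1 - \<rho>) + G)"
  \<comment> \<open>At most \<Lambda> defects of order
    \<open>\<epsilon>\<^sup>2 \<Lambda>\<^sup>2\<close> produce the exponent
    \<open>3 * (1 + \<gamma>)\<close>, the errors \<open>E\<close> produce
    \<open>1 + \<gamma> + s\<close>; this \<open>w\<close> dominates both.\<close>
  define w where "w = 3 * (1 + \<gamma>) + s"
  have nonneg: "0 \<le> G" "0 \<le> H" "0 \<le> F"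
    by (auto simp: G_def H_def F_def infnorm_pos_le)
  have "\<forall>\<^sub>F \<epsilon>::real in at_right 0. \<epsilon> * \<Lambda> \<epsilon> \<le> 1"
    unfolding \<Lambda>_def using \<gamma> by real_asymp
  then have "\<forall>\<^sub>F \<epsilon> in at_right 0.
      norm (cumulated_reward C \<mu> r P \<epsilon> - m \<bullet> g \<epsilon> 0) \<le> K * norm (\<epsilon> ^ 2 * ln (1 / \<epsilon>) powr w)"
    using E_le pos L_ge eventually_geometric_le_square[OF \<rho> \<gamma>]
  proof eventually_elim
    case (elim \<epsilon>)
    define L where "L = ln (1 / \<epsilon>)"
    define n where "n = nat \<lfloor>\<Lambda> \<epsilon>\<rfloor>"
    define D where "D = \<epsilon>\<^sup>2 * (\<Lambda> \<epsilon>)\<^sup>2 * H + c0 * (\<epsilon>\<^sup>2 * L powr s) * (infnorm r + G)"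
    have L: "1 \<le> L" using elim by (simp add: L_def)
    have \<Lambda>: "1 \<le> \<Lambda> \<epsilon>"
      using L \<gamma> by (simp add: \<Lambda>_def ge_one_powr_ge_zero flip: L_def)
    have n: "real n \<le> \<Lambda> \<epsilon>" "\<Lambda> \<epsilon> < real n + 1" "1 \<le> n"
      using \<Lambda> by (simp_all add: n_def le_nat_floor)
    have step: "infnorm (g \<epsilon> j - (step_reward C r (P (Suc j) \<epsilon>) + A \<epsilon> (Suc j) *v g \<epsilon> (Suc j))) \<le> D"
      and g_le: "infnorm (g \<epsilon> (Suc j)) \<le> G" if "j < n" for j
    proof -
      have j: "real (Suc j) \<le> \<Lambda> \<epsilon>"
        using that n by linarith
      \<comment> \<open>The matrix of step \<open>j + 1\<close> has drift
        \<open>\<epsilon> * j\<close>, matching the index \<open>j\<close> of the ansatz.\<close>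
      have Q: "P (Suc j) \<epsilon> = Pt + (\<epsilon> * real j) *\<^sub>R Pt1 + E \<epsilon> (Suc j)"
        by (simp add: E_def)
      note bounds = affine_value_defect_le[OF a[unfolded rt_def B_def] b[unfolded rt1_def B_def B1_def]
          c[unfolded B_def] Q g_def less_imp_le[OF elim(3)] j elim(1)]
      show "infnorm (g \<epsilon> (Suc j)) \<le> G"
        using bounds(2) by (simp add: G_def)
      have "mat_norm (E \<epsilon> (Suc j)) * (infnorm r + G) \<le> c0 * (\<epsilon>\<^sup>2 * L powr s) * (infnorm r + G)"
        using elim(2) j nonneg unfolding L_def
        by (intro mult_right_mono) (auto simp: infnorm_pos_le)
      then show "infnorm (g \<epsilon> j - (step_reward C r (P (Suc j) \<epsilon>) + A \<epsilon> (Suc j) *v g \<epsilon> (Suc j))) \<le> D"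
        using bounds(1) by (simp add: D_def G_def H_def A_def add.assoc)
    qed
    have reward_le: "infnorm (step_reward C r (P (Suc j) \<epsilon>)) \<le> F" for j
    proof -
      have "infnorm (step_reward C r (P (Suc j) \<epsilon>)) \<le> (1 + mat_norm (P (Suc j) \<epsilon>)) * infnorm r"
        by (rule infnorm_step_reward_le)
      also have "\<dots> \<le> 2 * infnorm r"
        using mat_norm_stochastic[OF stoch[of "Suc j" \<epsilon>]] elim
        by (intro mult_right_mono infnorm_pos_le) auto
      finally show ?thesis by (simp add: F_def)
    qed
    have "\<bar>cumulated_reward C \<mu> r P \<epsilon> - m \<bullet> g \<epsilon> 0\<bar>
        \<le> real n * D + inverse \<theta> * \<rho> ^ n * (F / (1 - \<rho>) + infnorm (g \<epsilon> n))"
      unfolding cumulated_reward_def m_def[symmetric] A_def[symmetric]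
      by (rule abs_suminf_matprod_diff_le[OF m A_le decay _ _ reward_le step])
        (use elim \<rho> in auto)
    also have "\<dots> \<le> \<Lambda> \<epsilon> * D
        + inverse \<theta> * (inverse \<rho> * (\<epsilon>\<^sup>2 * L powr w)) * (F / (1 - \<rho>) + G)"
    proof (intro add_mono mult_mono)
      \<comment> \<open>The bound on \<open>g\<close> concerns successors of indices below
        \<open>n\<close>; it reaches \<open>n\<close> itself because
        \<open>1 \<le> n\<close>.\<close>
      show "infnorm (g \<epsilon> n) \<le> G"
        using g_le[of "n - 1"] n by simp
      \<comment> \<open>Rounding \<Lambda> down to \<open>n\<close> loses less than one unit in the
        exponent, hence the factor \<open>inverse \<rho>\<close>.\<close>
      have "\<rho> ^ n = \<rho> powr real n"
        using \<rho> by (simp add: powr_realpow)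
      also have "\<dots> \<le> \<rho> powr (\<Lambda> \<epsilon> - 1)"
        using \<rho> n by (intro powr_mono') auto
      also have "\<dots> = inverse \<rho> * \<rho> powr \<Lambda> \<epsilon>"
        using \<rho> by (simp add: powr_diff divide_inverse mult.commute)
      also have "\<dots> \<le> inverse \<rho> * (\<epsilon>\<^sup>2 * L powr w)"
      proof (rule mult_left_mono)
        have "1 \<le> L powr w"
          using L \<gamma> \<open>s > 0\<close> by (simp add: w_def ge_one_powr_ge_zero)
        then have "\<epsilon>\<^sup>2 * 1 \<le> \<epsilon>\<^sup>2 * L powr w"
          by (intro mult_left_mono) auto
        then show "\<rho> powr \<Lambda> \<epsilon> \<le> \<epsilon>\<^sup>2 * L powr w"
          using elim(5) by (simp add: \<Lambda>_def)
      qed (use \<rho> in auto)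
      finally show "\<rho> ^ n \<le> inverse \<rho> * (\<epsilon>\<^sup>2 * L powr w)" .
    qed (use \<theta> \<rho> n \<Lambda> nonneg \<open>c0 > 0\<close> in \<open>auto simp: D_def infnorm_pos_le\<close>)
    also have "\<Lambda> \<epsilon> * D = \<epsilon>\<^sup>2 * (\<Lambda> \<epsilon>) ^ 3 * H + c0 * (\<epsilon>\<^sup>2 * (\<Lambda> \<epsilon> * L powr s)) * (infnorm r + G)"
      by (simp add: D_def algebra_simps power2_eq_square power3_eq_cube)
    also have "\<dots> \<le> \<epsilon>\<^sup>2 * L powr w * H + c0 * (\<epsilon>\<^sup>2 * L powr w) * (infnorm r + G)"
    proof -
      have "(\<Lambda> \<epsilon>) ^ 3 = L powr (3 * (1 + \<gamma>))"
        using L by (simp add: \<Lambda>_def L_def power3_eq_cube flip: powr_add)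
      also have "\<dots> \<le> L powr w"
        using L \<open>s > 0\<close> by (intro powr_mono) (auto simp: w_def)
      finally have 1: "(\<Lambda> \<epsilon>) ^ 3 \<le> L powr w" .
      have "\<Lambda> \<epsilon> * L powr s = L powr (1 + \<gamma> + s)"
        by (simp add: \<Lambda>_def L_def powr_add)
      also have "\<dots> \<le> L powr w"
        using L \<gamma> by (intro powr_mono) (auto simp: w_def)
      finally have 2: "\<Lambda> \<epsilon> * L powr s \<le> L powr w" .
      show ?thesis
        using 1 2 nonneg \<open>c0 > 0\<close>
        by (intro add_mono mult_right_mono mult_left_mono) (auto simp: infnorm_pos_le)
    qed
    also have "\<epsilon>\<^sup>2 * L powr w * H + c0 * (\<epsilon>\<^sup>2 * L powr w) * (infnorm r + G)
        + inverse \<theta> * (inverse \<rho> * (\<epsilon>\<^sup>2 * L powr w)) * (F / (1 - \<rho>) + G)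
        = K * (\<epsilon>\<^sup>2 * L powr w)"
      unfolding K_def by (simp only: distrib_left distrib_right mult_ac)
    finally show ?case
      by (simp add: L_def abs_mult)
  qed
  then have "(\<lambda>\<epsilon>. cumulated_reward C \<mu> r P \<epsilon> - m \<bullet> g \<epsilon> 0)
      \<in> O[at_right 0](\<lambda>\<epsilon>. \<epsilon> ^ 2 * ln (1 / \<epsilon>) powr w)"
    by (rule bigoI)
  then show ?thesis
    unfolding Let_def m_def[symmetric] B_def[symmetric] B1_def[symmetric] N_def[symmetric]
      rt_def[symmetric] rt1_def[symmetric] expansion by (rule exI)
qed

end
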